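(* Let $U$ be a set of atoms, let $P$ be an ordinary (unannotated) revision program over $U$, and let $B_I,B_R\subseteq U$. Then $B_R$ is a $P$-justified revision of $B_I$ (in the ordinary, unannotated sense) if and only if the necessary change $NC(P^a_{B_R^v}|B_I^v)$ is consistent and $B_R^v$ is a $P^a$-justified revision of $B_I^v$ (in the annotated sense, over the lattice $\mathcal{TWO}=\{\mathbf{f},\mathbf{t}\}$).
   Context: Ordinary revision programs: revision atoms are the formal expressions $\mathbf{in}(a)$, $\mathbf{out}(a)$, $a\in U$. An ordinary revision rule is $p\leftarrow q_1,\dots,q_m$ ($m\ge0$) with $p,q_1,\dots,q_m$ revision atoms; an ordinary revision program is a set of such rules. A set $B\subseteq U$ satisfies $\mathbf{in}(a)$ if $a\in B$ and satisfies $\mathbf{out}(a)$ if $a\notin B$. Ordinary justified revisions: given $P$, $B_I$, $B_R$, form the reduct by removing every rule of $P$ whose body contains a revision atom not satisfied by $B_R$, and then deleting from the remaining bodies every revision atom satisfied by $B_I$. Let $N$ be the least set of revision atoms closed under the rules of the reduct (revision atoms treated as independent propositional atoms of a Horn program), and $I=\{a:\mathbf{in}(a)\in N\}$, $O=\{a:\mathbf{out}(a)\in N\}$. $B_R$ is a $P$-justified revision of $B_I$ if $I\cap O=\emptyset$ and $B_R=(B_I\cup I)\setminus O$. Encoding: $\mathcal{TWO}=\{\mathbf{f},\mathbf{t}\}$ is the two-element lattice with $\mathbf{f}<\mathbf{t}$, with complement $\overline{\mathbf{f}}=\mathbf{t}$, $\overline{\mathbf{t}}=\mathbf{f}$. $P^a$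 is obtained from $P$ by replacing each rule $p\leftarrow q_1,\dots,q_m$ by $(p:\mathbf{t})\leftarrow(q_1:\mathbf{t}),\dots,(q_m:\mathbf{t})$. For $B\subseteq U$, $B^v$ is the $\mathcal{TWO}^2$-valuation with $B^v(a)=\langle\mathbf{t},\mathbf{f}\rangle$ if $a\in B$ and $B^v(a)=\langle\mathbf{f},\mathbf{t}\rangle$ otherwise. Annotated notions (here with $\mathcal{T}=\mathcal{TWO}$): an annotated revision atom is $(l:\alpha)$, $l$ a revision atom, $\alpha\in\mathcal{T}$; annotated rules $p\leftarrow q_1,\dots,q_n$ consist of annotated revision atoms; an annotated program is a set of them. $\mathcal{T}^2=\mathcal{T}\times\mathcal{T}$ is ordered componentwise by $\le_k$ with meet $\otimes$ and join $\oplus$; conflation is $-\langle\alpha,\beta\rangle=\langle\overline{\beta},\overline{\alpha}\rangle$. A $\mathcal{T}^2$-valuation is a map $B:U\to\mathcal{T}^2$; all operations are pointwise; $B$ is consistent if $B\le_k -B$. If $B(a)=\langle\alpha,\beta\rangle$, write $B[\mathbf{in}(a)]=\alpha$, $B[\mathbf{out}(a)]=\beta$; $B$ satisfies $(l:\alpha)$ if $\alpha\le B[l]$, and a body if it satisfies each member. For an annotated program $Q$, $T_Q^b(B)[l]=\bigvee\{\alpha:(l:\alpha)$ is the head of a rule of $Q$ whose body is satisfied by $B\}$; this operator is monotone and its least fixpoint is the necessary change $NC(Q)$. $\mathit{pcomp}(\alpha,\beta)$ is the least $\gamma$ with $\alpha\vee\gamma\ge\beta$. The reduct $Q_{B_R}|B_I$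 is obtained from $Q$ by (1) removing every rule whose body contains an annotated revision atom not satisfied by $B_R$, and (2) replacing each $(l:\beta)$ in the bodies of remaining rules by $(l:\mathit{pcomp}(B_I[l],\beta))$. $B_R$ is a $Q$-justified revision of $B_I$ if $B_R=(B_I\otimes -C)\oplus C$ with $C=NC(Q_{B_R}|B_I)$. *)

theory Defs
  imports Main "HOL-Library.Product_Order"
begin

text \<open>The universe of atoms is the type variable \<open>'u\<close>.\<close>

datatype 'u rev_atom = In 'u | Out 'u

text \<open>Rules are shared by the ordinary case (\<open>'l\<close> is \<open>'u rev_atom\<close>) and the annotated case
  (\<open>'l\<close> is \<open>'u rev_atom \<times> 't\<close>). The body is a list, hence finite and possibly empty; programs are
  arbitrary sets of rules.\<close>

datatype 'l rule = Rule (head: 'l) (body: "'l list")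

section \<open>Ordinary revision programs\<close>

type_synonym 'u program = "'u rev_atom rule set"

fun sat :: "'u set \<Rightarrow> 'u rev_atom \<Rightarrow> bool" where
  "sat B (In a) \<longleftrightarrow> a \<in> B"
| "sat B (Out a) \<longleftrightarrow> a \<notin> B"

definition reduct :: "'u program \<Rightarrow> 'u set \<Rightarrow> 'u set \<Rightarrow> 'u program" where
  "reduct P B\<^sub>R B\<^sub>I =
     {Rule (head r) (filter (\<lambda>q. \<not> sat B\<^sub>I q) (body r)) | r.
        r \<in> P \<and> (\<forall>q \<in> set (body r). sat B\<^sub>R q)}"

inductive_set least_model :: "'l rule set \<Rightarrow> 'l set" for P where
  "r \<in> P \<Longrightarrow> \<forall>q \<in> set (body r). q \<in> least_model P \<Longrightarrow> head r \<in> least_model P"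

definition justified_revision :: "'u program \<Rightarrow> 'u set \<Rightarrow> 'u set \<Rightarrow> bool" where
  "justified_revision P B\<^sub>I B\<^sub>R \<longleftrightarrow>
     (let N = least_model (reduct P B\<^sub>R B\<^sub>I);
          I = {a. In a \<in> N};
          O' = {a. Out a \<in> N}
      in I \<inter> O' = {} \<and> B\<^sub>R = (B\<^sub>I \<union> I) - O')"

section \<open>Annotated revision programs\<close>

text \<open>Annotations come from a complete lattice \<open>'t\<close>, with complement written \<open>-\<close>. On
  \<open>'t \<times> 't\<close> the knowledge order, meet and join are the componentwise \<open>\<le>\<close>, \<open>\<sqinter>\<close> and \<open>\<squnion>\<close> of
  \<^theory>\<open>HOL-Library.Product_Order\<close>, lifted pointwise to valuations.\<close>

type_synonym ('u, 't) ann_atom = "'u rev_atom \<times> 't"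
type_synonym ('u, 't) ann_program = "('u, 't) ann_atom rule set"
type_synonym ('u, 't) valuation = "'u \<Rightarrow> 't \<times> 't"

definition conflation ::
    "('u, 't::{complete_lattice, uminus}) valuation \<Rightarrow> ('u, 't) valuation" where
  "conflation B = (\<lambda>a. (- snd (B a), - fst (B a)))"

definition consistent :: "('u, 't::{complete_lattice, uminus}) valuation \<Rightarrow> bool" where
  "consistent B \<longleftrightarrow> B \<le> conflation B"

fun val_at :: "('u, 't) valuation \<Rightarrow> 'u rev_atom \<Rightarrow> 't" where
  "val_at B (In a) = fst (B a)"
| "val_at B (Out a) = snd (B a)"

fun ann_sat :: "('u, 't::complete_lattice) valuation \<Rightarrow> ('u, 't) ann_atom \<Rightarrow> bool" where
  "ann_sat B (l, \<alpha>) \<longleftrightarrow> \<alpha> \<le> val_at B l"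

definition head_annotations ::
    "('u, 't::complete_lattice) ann_program \<Rightarrow> ('u, 't) valuation \<Rightarrow> 'u rev_atom \<Rightarrow> 't set" where
  "head_annotations Q B l =
     {\<alpha>. \<exists>r \<in> Q. head r = (l, \<alpha>) \<and> (\<forall>q \<in> set (body r). ann_sat B q)}"

definition T_b ::
    "('u, 't::complete_lattice) ann_program \<Rightarrow> ('u, 't) valuation \<Rightarrow> ('u, 't) valuation" where
  "T_b Q B = (\<lambda>a. (Sup (head_annotations Q B (In a)), Sup (head_annotations Q B (Out a))))"

lemma ann_sat_mono:
  assumes "B \<le> B'" "ann_sat B q"
  shows "ann_sat B' q"
proof -
  obtain l \<alpha> where q: "q = (l, \<alpha>)" by force
  have "val_at B l \<le> val_at B' l"
    using assms(1) by (cases l) (auto simp: le_fun_def less_eq_prod_def)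
  with assms(2) q show ?thesis by auto
qed

lemma mono_T_b:
  fixes Q :: "('u, 't::complete_lattice) ann_program"
  shows "mono (T_b Q)"
proof (rule monoI)
  fix B B' :: "('u, 't) valuation"
  assume "B \<le> B'"
  then have "head_annotations Q B l \<subseteq> head_annotations Q B' l" for l
    unfolding head_annotations_def by (blast intro: ann_sat_mono)
  then show "T_b Q B \<le> T_b Q B'"
    by (auto simp: T_b_def le_fun_def less_eq_prod_def intro!: Sup_subset_mono)
qed

definition NC :: "('u, 't::complete_lattice) ann_program \<Rightarrow> ('u, 't) valuation" where
  "NC Q = lfp (T_b Q)"

definition pcomp :: "'t::complete_lattice \<Rightarrow> 't \<Rightarrow> 't" where
  "pcomp \<alpha> \<beta> = (LEAST \<gamma>. \<beta> \<le> sup \<alpha> \<gamma>)"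

lemma pcomp_bool: "pcomp \<alpha> \<beta> \<longleftrightarrow> \<beta> \<and> \<not> \<alpha>"
  unfolding pcomp_def by (rule Least_equality) auto

definition ann_reduct ::
    "('u, 't::complete_lattice) ann_program \<Rightarrow> ('u, 't) valuation \<Rightarrow> ('u, 't) valuation
      \<Rightarrow> ('u, 't) ann_program" where
  "ann_reduct Q B\<^sub>R B\<^sub>I =
     {Rule (head r) (map (\<lambda>(l, \<beta>). (l, pcomp (val_at B\<^sub>I l) \<beta>)) (body r)) | r.
        r \<in> Q \<and> (\<forall>q \<in> set (body r). ann_sat B\<^sub>R q)}"

definition ann_justified_revision ::
    "('u, 't::{complete_lattice, uminus}) ann_program \<Rightarrow> ('u, 't) valuation
      \<Rightarrow> ('u, 't) valuation \<Rightarrow> bool" where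
  "ann_justified_revision Q B\<^sub>I B\<^sub>R \<longleftrightarrow>
     (let C = NC (ann_reduct Q B\<^sub>R B\<^sub>I)
      in B\<^sub>R = sup (inf B\<^sub>I (conflation C)) C)"

section \<open>Encoding over the two-element lattice\<close>

text \<open>The lattice \<open>TWO\<close> is \<^typ>\<open>bool\<close>: there \<^prop>\<open>False < True\<close> and \<open>-\<close> is negation.\<close>

definition ann_of :: "'u program \<Rightarrow> ('u, bool) ann_program" where
  "ann_of P = map_rule (\<lambda>l. (l, True)) ` P"

definition val_of :: "'u set \<Rightarrow> ('u, bool) valuation" where
  "val_of B = (\<lambda>a. if a \<in> B then (True, False) else (False, True))"

end

theory Submission
  imports Defs
begin

text \<open>Over the two-element lattice a valuation is just a set of revision atoms, and an annotation
  \<open>False\<close> is satisfied by every valuation. So replacing a body atom satisfied by \<open>B\<^sub>I\<close> by one annotated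
  \<open>pcomp True True = False\<close> has the same effect as deleting it: the necessary change of the annotated
  reduct is the least model of the ordinary one. Consistency then says \<open>I \<inter> O = {}\<close>, and for
  disjoint \<open>I\<close> and \<open>O\<close> the two update formulas agree.\<close>

lemma val_at_val_of [simp]: "val_at (val_of B) l \<longleftrightarrow> sat B l"
  by (cases l) (auto simp: val_of_def)

text \<open>Lets the order be checked one revision atom at a time, with \<open>In\<close> and
  \<open>Out\<close> treated uniformly.\<close>

lemma le_valuation_iff: "B \<le> B' \<longleftrightarrow> (\<forall>l. val_at B l \<le> val_at B' l)"
proof
  assume le: "B \<le> B'"
  show "\<forall>l. val_at B l \<le> val_at B' l"
  proof
    fix l show "val_at B l \<le> val_at B' l"
      using le by (cases l) (auto simp: le_fun_def less_eq_prod_def)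
  qed
next
  assume le: "\<forall>l. val_at B l \<le> val_at B' l"
  show "B \<le> B'"
    unfolding le_fun_def less_eq_prod_def
    using le[rule_format, of "In a" for a] le[rule_format, of "Out a" for a] by simp
qed

lemma val_at_T_b: "val_at (T_b Q B) l = Sup (head_annotations Q B l)"
  by (cases l) (auto simp: T_b_def)

text \<open>A \<open>Sup\<close> of truth values is \<open>True\<close> iff some member is, and
  every head carries \<open>True\<close>. So \<open>T_b\<close> acts as the one-step consequence
  operator of the ordinary reduct.\<close>

lemma val_at_T_b_ann_reduct:
  "val_at (T_b (ann_reduct (ann_of P) (val_of B\<^sub>R) (val_of B\<^sub>I)) B) l \<longleftrightarrow>
     (\<exists>r \<in> reduct P B\<^sub>R B\<^sub>I. head r = l \<and> (\<forall>q \<in> set (body r). val_at B q))"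
proof -
  have "val_at (T_b (ann_reduct (ann_of P) (val_of B\<^sub>R) (val_of B\<^sub>I)) B) l \<longleftrightarrow>
     (\<exists>r \<in> P. (\<forall>q \<in> set (body r). sat B\<^sub>R q) \<and> head r = l \<and>
       (\<forall>q \<in> set (body r). sat B\<^sub>I q \<or> val_at B q))"
    by (force simp: val_at_T_b head_annotations_def ann_reduct_def ann_of_def rule.map_sel
        rule.set_map pcomp_bool)
  also have "\<dots> \<longleftrightarrow> (\<exists>r \<in> reduct P B\<^sub>R B\<^sub>I. head r = l \<and> (\<forall>q \<in> set (body r). val_at B q))"
    by (force simp: reduct_def)
  finally show ?thesis .
qed

lemma val_at_NC_ann_reduct:
  "val_at (NC (ann_reduct (ann_of P) (val_of B\<^sub>R) (val_of B\<^sub>I))) l \<longleftrightarrow>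
     l \<in> least_model (reduct P B\<^sub>R B\<^sub>I)"
proof
  let ?T = "T_b (ann_reduct (ann_of P) (val_of B\<^sub>R) (val_of B\<^sub>I))"
  let ?N = "least_model (reduct P B\<^sub>R B\<^sub>I)"
  \<comment> \<open>The least model read as a valuation; being a prefixed point of
    \<open>?T\<close>, it bounds the least fixpoint from above.\<close>
  define M where "M = (\<lambda>a. (In a \<in> ?N, Out a \<in> ?N))"
  have val_at_M: "val_at M k \<longleftrightarrow> k \<in> ?N" for k
    by (cases k) (auto simp: M_def)
  have "?T M \<le> M"
    by (auto simp: le_valuation_iff val_at_T_b_ann_reduct val_at_M intro: least_model.intros)
  then have "NC (ann_reduct (ann_of P) (val_of B\<^sub>R) (val_of B\<^sub>I)) \<le> M"
    unfolding NC_def by (rule lfp_lowerbound)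
  then show "l \<in> ?N" if "val_at (NC (ann_reduct (ann_of P) (val_of B\<^sub>R) (val_of B\<^sub>I))) l"
    using that by (auto simp: le_valuation_iff val_at_M)
  show "val_at (NC (ann_reduct (ann_of P) (val_of B\<^sub>R) (val_of B\<^sub>I))) l" if "l \<in> ?N"
    using that
  \<comment> \<open>Conversely, the least fixpoint is closed under each rule of the reduct.\<close>
  proof induction
    case (1 r)
    then have "val_at (?T (lfp ?T)) (head r)"
      by (auto simp: val_at_T_b_ann_reduct NC_def)
    then show ?case
      unfolding NC_def using lfp_unfold[OF mono_T_b] by metis
  qed
qed

theorem theorem5p1:
  fixes P :: "'u program" and B\<^sub>I B\<^sub>R :: "'u set"
  shows "justified_revision P B\<^sub>I B\<^sub>R \<longleftrightarrow>
    consistent (NC (ann_reduct (ann_of P) (val_of B\<^sub>R) (val_of B\<^sub>I))) \<and>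
    ann_justified_revision (ann_of P) (val_of B\<^sub>I) (val_of B\<^sub>R)"
proof -
  let ?N = "least_model (reduct P B\<^sub>R B\<^sub>I)"
  have NC: "NC (ann_reduct (ann_of P) (val_of B\<^sub>R) (val_of B\<^sub>I)) = (\<lambda>a. (In a \<in> ?N, Out a \<in> ?N))"
    by (simp add: fun_eq_iff prod_eq_iff flip: val_at_NC_ann_reduct)
  have "consistent (NC (ann_reduct (ann_of P) (val_of B\<^sub>R) (val_of B\<^sub>I))) \<longleftrightarrow>
      {a. In a \<in> ?N} \<inter> {a. Out a \<in> ?N} = {}"
    unfolding NC consistent_def conflation_def by (auto simp: le_fun_def)
  \<comment> \<open>Disjointness matters: where both sets contain an atom, the annotated update
    gives \<open>(True, True)\<close>, never a value of \<open>val_of\<close>, while the set formula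
    merely drops the atom.\<close>
  moreover have "ann_justified_revision (ann_of P) (val_of B\<^sub>I) (val_of B\<^sub>R) \<longleftrightarrow>
      B\<^sub>R = (B\<^sub>I \<union> {a. In a \<in> ?N}) - {a. Out a \<in> ?N}"
    if "{a. In a \<in> ?N} \<inter> {a. Out a \<in> ?N} = {}"
    using that unfolding ann_justified_revision_def Let_def NC conflation_def
    by (auto simp: fun_eq_iff val_of_def set_eq_iff prod_eq_iff)
  ultimately show ?thesis
    unfolding justified_revision_def Let_def by blast
qed

end
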